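(* Let $K \subset \mathbb{R}^n$ be a compact convex set that is not a singleton. Then $K$ is the closed convex hull of the set of its antipodally exposed points.
   Context: A hyperplane $H \subset \mathbb{R}^n$ supports a convex set $K$ if $H \cap K \neq \varnothing$ and $K$ lies in one of the two closed halfspaces bounded by $H$. Points $x$ and $z$ of a compact convex set $K \subset \mathbb{R}^n$ are called antipodally exposed if there are distinct parallel hyperplanes $H$ and $G$, both supporting $K$, such that $H \cap K = \{x\}$ and $G \cap K = \{z\}$. A single point $x \in K$ is called an antipodally exposed point of $K$ if there is a point $z \in K$ such that $x$ and $z$ are antipodally exposed in this sense. *)

theory Defs
  imports "HOL-Analysis.Analysis"
begin

definition supporting_hyperplane :: "'a::euclidean_space set \<Rightarrow> 'a set \<Rightarrow> bool" where
  "supporting_hyperplane H K \<longleftrightarrow>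
     (\<exists>a b. a \<noteq> 0 \<and> H = {y. a \<bullet> y = b} \<and> H \<inter> K \<noteq> {} \<and>
            (K \<subseteq> {y. a \<bullet> y \<le> b} \<or> K \<subseteq> {y. a \<bullet> y \<ge> b}))"

(* Normal vectors of a hyperplane are determined up to a nonzero factor, so
   hyperplanes are parallel iff they can be described with one common normal.
   A hyperplane counts as parallel to itself. *)
definition parallel_hyperplanes :: "'a::euclidean_space set \<Rightarrow> 'a set \<Rightarrow> bool" where
  "parallel_hyperplanes H G \<longleftrightarrow>
     (\<exists>a b c. a \<noteq> 0 \<and> H = {y. a \<bullet> y = b} \<and> G = {y. a \<bullet> y = c})"

definition antipodally_exposed :: "'a::euclidean_space set \<Rightarrow> 'a \<Rightarrow> 'a \<Rightarrow> bool" where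
  "antipodally_exposed K x z \<longleftrightarrow>
     (\<exists>H G. H \<noteq> G \<and> parallel_hyperplanes H G \<and>
            supporting_hyperplane H K \<and> supporting_hyperplane G K \<and>
            H \<inter> K = {x} \<and> G \<inter> K = {z})"

definition antipodally_exposed_points :: "'a::euclidean_space set \<Rightarrow> 'a set" where
  "antipodally_exposed_points K = {x \<in> K. \<exists>z\<in>K. antipodally_exposed K x z}"

end

theory Submission
  imports Defs
begin

text \<open>
  The directions that expose antipodal points are dense. Fix a vector \<open>u\<close>, and let the pair
  \<open>(x, z)\<close> maximise the length of \<open>(x - z) + u\<close> over \<open>K \<times> K\<close>. In other words, \<open>x - z\<close> is
  the point of the difference body \<open>K - K\<close> farthest from \<open>- u\<close>. The ball centred at \<open>- u\<close> through
  this point contains \<open>K - K\<close>, and a ball is strictly convex, so the normal \<open>v = (x - z) + u\<close> exposes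
  \<open>x - z\<close> in \<open>K - K\<close>. For \<open>K\<close> itself this means that \<open>v\<close> is maximised only at \<open>x\<close> and minimised
  only at \<open>z\<close>. Thus \<open>x\<close> and \<open>z\<close> are antipodally exposed (\<open>exists_antipodally_exposed_normal\<close>).

  Now suppose that \<open>p \<in> K\<close> lies outside the closed convex hull of the antipodally exposed points, and
  let \<open>a\<close> be the normal of a hyperplane that separates them strictly, with the hull on the side to
  which \<open>a\<close> points. Take \<open>u = - t a\<close> with \<open>t\<close> large. Then \<open>v\<close> differs from \<open>- t a\<close> by at most the
  diameter of \<open>K\<close>, so \<open>p\<close>, which beats every point of the hull in the direction \<open>- a\<close>, also
  beats \<open>x\<close> in the direction \<open>v\<close>. This contradicts that \<open>x\<close> maximises \<open>v\<close> on \<open>K\<close>.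
\<close>

text \<open>The level sets of \<open>v\<close> through \<open>x\<close> and \<open>z\<close> serve as the two hyperplanes. They are distinct:
  if the maximum and the minimum of \<open>v\<close> agreed, then \<open>v\<close> would be constant on \<open>K\<close>, and its
  unique maximiser would be the only point of \<open>K\<close>.\<close>

lemma antipodally_exposedI:
  fixes K :: "'a::euclidean_space set"
  assumes x: "x \<in> K" and z: "z \<in> K" and not_singleton: "K \<noteq> {x}"
    and max: "\<And>y. y \<in> K \<Longrightarrow> y \<noteq> x \<Longrightarrow> v \<bullet> y < v \<bullet> x"
    and min: "\<And>y. y \<in> K \<Longrightarrow> y \<noteq> z \<Longrightarrow> v \<bullet> z < v \<bullet> y"
  shows "antipodally_exposed K x z"
proof -
  define H where "H = {y. v \<bullet> y = v \<bullet> x}"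
  define G where "G = {y. v \<bullet> y = v \<bullet> z}"
  obtain w where w: "w \<in> K" "w \<noteq> x"
    using x not_singleton by blast
  have "v \<noteq> 0"
    using max[OF w] by auto
  have "v \<bullet> z < v \<bullet> x"
    using max[OF w] min[OF w(1)] by (cases "w = z") auto
  then have "H \<noteq> G"
    unfolding H_def G_def by force
  moreover have "parallel_hyperplanes H G"
    unfolding parallel_hyperplanes_def H_def G_def using \<open>v \<noteq> 0\<close> by blast
  moreover have HK: "H \<inter> K = {x}" and GK: "G \<inter> K = {z}"
    unfolding H_def G_def using x z max min by force+
  moreover have "supporting_hyperplane H K"
  proof -
    have "K \<subseteq> {y. v \<bullet> y \<le> v \<bullet> x}"
      using max by force
    then show ?thesis
      unfolding supporting_hyperplane_def using \<open>v \<noteq> 0\<close> HK H_def by blast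
  qed
  moreover have "supporting_hyperplane G K"
  proof -
    have "K \<subseteq> {y. v \<bullet> y \<ge> v \<bullet> z}"
      using min by force
    then show ?thesis
      unfolding supporting_hyperplane_def using \<open>v \<noteq> 0\<close> GK G_def by blast
  qed
  ultimately show ?thesis
    unfolding antipodally_exposed_def by blast
qed

text \<open>The sphere about the origin through \<open>v\<close> touches its tangent hyperplane only at \<open>v\<close>; here
  \<open>d\<close> is the displacement from \<open>v\<close> to another point of the ball.\<close>

lemma inner_neg_if_norm_add_le:
  fixes v d :: "'a::real_inner"
  assumes "norm (v + d) \<le> norm v" and "d \<noteq> 0"
  shows "v \<bullet> d < 0"
proof -
  have "(v + d) \<bullet> (v + d) \<le> v \<bullet> v"
    using assms(1) by (simp add: norm_le)
  moreover have "d \<bullet> d > 0"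
    using assms(2) by simp
  moreover have "(v + d) \<bullet> (v + d) = v \<bullet> v + 2 * (v \<bullet> d) + d \<bullet> d"
    by (simp add: inner_add_left inner_add_right inner_commute)
  ultimately show ?thesis
    by linarith
qed

text \<open>The antipodal pair is the one that maximises \<open>norm (x - z + u)\<close>. Replacing \<open>x\<close> or \<open>z\<close> alone
  by another point of \<open>K\<close> moves \<open>x - z + u\<close> within the ball on whose boundary it lies, which
  gives the two strict inequalities separately.\<close>

lemma exists_antipodally_exposed_normal:
  fixes K :: "'a::euclidean_space set" and u :: 'a
  assumes "compact K" and "K \<noteq> {}" and not_singleton: "\<nexists>p. K = {p}"
  obtains x z where "x \<in> K" "z \<in> K" "antipodally_exposed K x z"
    and "\<And>y. y \<in> K \<Longrightarrow> (x - z + u) \<bullet> y \<le> (x - z + u) \<bullet> x"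
proof -
  have "compact (K \<times> K)" "K \<times> K \<noteq> {}"
    using assms by (auto intro: compact_Times)
  moreover have "continuous_on (K \<times> K) (\<lambda>q. norm (fst q - snd q + u))"
    by (intro continuous_intros)
  ultimately obtain q where q: "q \<in> K \<times> K"
    and "\<forall>r\<in>K \<times> K. norm (fst r - snd r + u) \<le> norm (fst q - snd q + u)"
    using continuous_attains_sup by blast
  moreover obtain x z where "q = (x, z)"
    by fastforce
  ultimately have x: "x \<in> K" and z: "z \<in> K"
    and far: "\<And>y w. y \<in> K \<Longrightarrow> w \<in> K \<Longrightarrow> norm (y - w + u) \<le> norm (x - z + u)"
    by auto
  define v where "v = x - z + u"
  have max: "v \<bullet> y < v \<bullet> x" if "y \<in> K" "y \<noteq> x" for y
  proof -
    have "norm (v + (y - x)) \<le> norm v"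
      using far[OF that(1) z] by (simp add: v_def algebra_simps)
    then have "v \<bullet> (y - x) < 0"
      using that(2) by (intro inner_neg_if_norm_add_le) auto
    then show ?thesis
      by (simp add: inner_diff_right)
  qed
  have min: "v \<bullet> z < v \<bullet> y" if "y \<in> K" "y \<noteq> z" for y
  proof -
    have "norm (v + (z - y)) \<le> norm v"
      using far[OF x that(1)] by (simp add: v_def algebra_simps)
    then have "v \<bullet> (z - y) < 0"
      using that(2) by (intro inner_neg_if_norm_add_le) auto
    then show ?thesis
      by (simp add: inner_diff_right)
  qed
  have "antipodally_exposed K x z"
    using x z not_singleton max min by (intro antipodally_exposedI[of x K z v]) auto
  moreover have "v \<bullet> y \<le> v \<bullet> x" if "y \<in> K" for y
    using max[OF that] by (cases "y = x") auto
  ultimately show thesis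
    using that x z by (simp add: v_def)
qed

theorem theorem2:
  fixes K :: "(real ^ 'n) set"
  assumes "compact K" and "convex K" and "\<nexists>p. K = {p}"
  shows "K = closure (convex hull (antipodally_exposed_points K))"
proof
  let ?E = "antipodally_exposed_points K"
  let ?S = "closure (convex hull ?E)"
  have "?E \<subseteq> K"
    by (auto simp: antipodally_exposed_points_def)
  then have "convex hull ?E \<subseteq> K"
    by (simp add: assms(2) subset_hull)
  then show "?S \<subseteq> K"
    by (simp add: assms(1) closure_minimal compact_imp_closed)
  show "K \<subseteq> ?S"
  proof (rule subsetI, rule ccontr)
    fix p
    assume p: "p \<in> K" and "p \<notin> ?S"
    moreover have "convex ?S"
      by (simp add: convex_closure)
    ultimately obtain a b where a: "a \<bullet> p < b" "\<And>y. y \<in> ?S \<Longrightarrow> b < a \<bullet> y"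
      using separating_hyperplane_closed_point[of ?S p] by auto
    have D: "dist y w \<le> diameter K" if "y \<in> K" "w \<in> K" for y w
      using that assms(1) by (simp add: compact_imp_bounded diameter_bounded_bound)
    \<comment> \<open>The factor \<open>t\<close> is chosen so that the gain \<open>t (b - a \<bullet> p)\<close> of \<open>p\<close> over the hull exceeds the
      square of the diameter, which bounds the error term \<open>(x - z) \<bullet> (x - p)\<close>.\<close>
    define t where "t = ((diameter K)\<^sup>2 + 1) / (b - a \<bullet> p)"
    have t: "t > 0" "t * (b - a \<bullet> p) = (diameter K)\<^sup>2 + 1"
      using a(1) by (auto simp: t_def intro!: divide_pos_pos add_nonneg_pos)
    obtain x z where x: "x \<in> K" and z: "z \<in> K" and "antipodally_exposed K x z"
      and max: "\<And>y. y \<in> K \<Longrightarrow> (x - z + (- t) *\<^sub>R a) \<bullet> y \<le> (x - z + (- t) *\<^sub>R a) \<bullet> x"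
      using exists_antipodally_exposed_normal[of K "(- t) *\<^sub>R a"] assms(1,3) p by blast
    then have "x \<in> ?E"
      by (auto simp: antipodally_exposed_points_def)
    then have "x \<in> ?S"
      by (meson closure_subset hull_inc subsetD)
    then have "t * b \<le> t * (a \<bullet> x)"
      using a(2)[of x] t(1) by simp
    moreover have "t * (a \<bullet> x) - t * (a \<bullet> p) \<le> (x - z) \<bullet> (x - p)"
      using max[OF p] by (simp add: inner_add_left inner_diff_left inner_diff_right)
    moreover have "(x - z) \<bullet> (x - p) \<le> (diameter K)\<^sup>2"
    proof -
      have "(x - z) \<bullet> (x - p) \<le> dist x z * dist x p"
        by (simp add: dist_norm norm_cauchy_schwarz)
      also have "\<dots> \<le> diameter K * diameter K"
        using D[OF x z] D[OF x p] by (intro mult_mono) (auto intro: order_trans[OF zero_le_dist])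
      finally show ?thesis
        by (simp add: power2_eq_square)
    qed
    ultimately show False
      using t(2) by (simp add: right_diff_distrib)
  qed
qed

end
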